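(* Let $m\ge2$ and $0\le r\le 2m$. If an independent exact $r$-cover of $\mathbb Z^m$ exists, then \[ \left(\left(\frac{2m-r}{2m}\right)^2,\ \frac{2m-r}{2m}\right)\in\mathcal P(\mathcal T^m). \]
   Context: $\mathbb Z^m$ is the infinite grid graph: two points are adjacent iff they differ by $\pm1$ in exactly one coordinate. For a $d$-regular graph $G$ and $0\le r\le d$, a set $S\subseteq V(G)$ is an independent exact $r$-cover if $S$ is an independent set and every vertex not in $S$ is adjacent to exactly $r$ elements of $S$. For $k\in\mathbb N$, $T^m_k$ is the torus with vertex set $[k]^m$, where two vertices are adjacent iff they differ in exactly one coordinate $j$ and there $x_j\equiv y_j\pm1\pmod k$; $\mathcal T^m=(T^m_k)_{k\ge1}$. A balanced colouring is a partition of the vertex set into $R,B$ with $|R|=|B|$. For a vertex set $S$, $P_2(S)$ is the probability that a simple random walk (moving to a uniformly random neighbour each step) started at a uniformly random vertex of $S$ is in $S$ after steps 1 and 2. For a sequence $\mathcal G=(G_k)$, $(x,y)\in\mathcal P(\mathcal G)$ iff for every $\epsilon>0$ there are $k$ and a balanced colouring $(R,B)$ of $G_k$ with $|P_2(R)-x|<\epsilon$ and $|P_2(B)-y|<\epsilon$. *)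

theory Defs
  imports "HOL-Probability.Probability" "HOL-Number_Theory.Cong"
begin

record 'a sgraph =
  verts :: "'a set"
  adj :: "'a \<Rightarrow> 'a \<Rightarrow> bool"

definition nbrs :: "'a sgraph \<Rightarrow> 'a \<Rightarrow> 'a set" where
  "nbrs G v = {w \<in> verts G. adj G v w}"

definition independent_set :: "'a sgraph \<Rightarrow> 'a set \<Rightarrow> bool" where
  "independent_set G S \<longleftrightarrow> S \<subseteq> verts G \<and> (\<forall>v\<in>S. \<forall>w\<in>S. \<not> adj G v w)"

(* Meant for locally finite graphs, so that card counts the neighbours in S
   even when S is infinite. *)
definition independent_exact_cover :: "'a sgraph \<Rightarrow> nat \<Rightarrow> 'a set \<Rightarrow> bool" where
  "independent_exact_cover G r S \<longleftrightarrow>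
     independent_set G S \<and> (\<forall>v \<in> verts G - S. card (nbrs G v \<inter> S) = r)"

(* Points with m integer coordinates are extensional functions on {1..m}, so that
   equality of points is equality of all m coordinates. *)
definition grid :: "nat \<Rightarrow> (nat \<Rightarrow> int) sgraph" where
  "grid m = \<lparr>verts = {1..m} \<rightarrow>\<^sub>E UNIV,
     adj = (\<lambda>x y. \<exists>j\<in>{1..m}. \<bar>x j - y j\<bar> = 1 \<and> (\<forall>i\<in>{1..m}. i \<noteq> j \<longrightarrow> x i = y i))\<rparr>"

definition torus :: "nat \<Rightarrow> nat \<Rightarrow> (nat \<Rightarrow> int) sgraph" where
  "torus m k = \<lparr>verts = {1..m} \<rightarrow>\<^sub>E {1..int k},
     adj = (\<lambda>x y. \<exists>j\<in>{1..m}. x j \<noteq> y j \<and>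
              ([x j = y j + 1] (mod int k) \<or> [x j = y j - 1] (mod int k)) \<and>
              (\<forall>i\<in>{1..m}. i \<noteq> j \<longrightarrow> x i = y i))\<rparr>"

definition balanced_colouring :: "'a sgraph \<Rightarrow> 'a set \<Rightarrow> 'a set \<Rightarrow> bool" where
  "balanced_colouring G R B \<longleftrightarrow>
     finite (verts G) \<and> R \<union> B = verts G \<and> R \<inter> B = {} \<and> card R = card B"

(* Joint law of the positions after steps 1 and 2.  It is meaningful only for finite
   nonempty S and finite nonempty neighbourhoods, since pmf_of_set is unspecified on
   other sets; the one-vertex torus (k = 1) has an isolated vertex but, having an odd
   number of vertices, no balanced colouring. *)
definition two_step_walk :: "'a sgraph \<Rightarrow> 'a set \<Rightarrow> ('a \<times> 'a) pmf" where
  "two_step_walk G S =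
     bind_pmf (pmf_of_set S) (\<lambda>v0.
     bind_pmf (pmf_of_set (nbrs G v0)) (\<lambda>v1.
     bind_pmf (pmf_of_set (nbrs G v1)) (\<lambda>v2.
     return_pmf (v1, v2))))"

definition P2 :: "'a sgraph \<Rightarrow> 'a set \<Rightarrow> real" where
  "P2 G S = measure_pmf.prob (two_step_walk G S) {(v1, v2). v1 \<in> S \<and> v2 \<in> S}"

(* Sequences of graphs are indexed by k \<ge> 1; the value at 0 is ignored. *)
definition achievable_pairs :: "(nat \<Rightarrow> 'a sgraph) \<Rightarrow> (real \<times> real) set" where
  "achievable_pairs \<G> = {(x, y). \<forall>\<epsilon>>0. \<exists>k\<ge>1. \<exists>R B. balanced_colouring (\<G> k) R B \<and>
     \<bar>P2 (\<G> k) R - x\<bar> < \<epsilon> \<and> \<bar>P2 (\<G> k) B - y\<bar> < \<epsilon>}"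

end

theory Submission
  imports Defs
begin

text \<open>
  Put \<open>d = 2m\<close> and let \<open>S\<close> be an exact \<open>r\<close>-cover of the grid. Cut the torus of even side \<open>k\<close>
  by a slab \<open>x 1 \<le> t\<close>, colour the points of the slab outside \<open>S\<close> red and everything else blue.
  Up to boundary effects, a red vertex has \<open>d - r\<close> red neighbours, so the red value is
  \<open>((d - r) / d)\<^sup>2\<close>; a blue vertex has only red neighbours inside the slab and only blue ones
  outside it, so the blue value is the proportion of blue vertices outside the slab.
  Choose \<open>t\<close> so that about half of the torus is red. Counting the edges between \<open>S\<close> and its
  complement in the slab gives \<open>d |blue in slab| \<approx> r |red|\<close>, hence that proportion is
  \<open>1 - r / d\<close>. All errors, including the recolouring of a set of vertices needed for exact balance,
  come from \<open>O(k ^ (m - 1))\<close> vertices out of \<open>k ^ m\<close>.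
\<close>

section \<open>Averages with few exceptional terms, and walk probabilities as finite sums\<close>

text \<open>Triangle inequality: only terms in \<open>X \<inter> Z\<close> survive. Every count
  below that is exact up to exceptional vertices goes through this bound.\<close>

lemma sum_approx:
  fixes f g :: "'a \<Rightarrow> real"
  assumes "finite X" and "finite Z" and "b \<ge> 0"
    and "\<And>v. v \<in> X \<Longrightarrow> \<bar>f v - g v\<bar> \<le> b"
    and "\<And>v. v \<in> X - Z \<Longrightarrow> f v = g v"
  shows "\<bar>sum f X - sum g X\<bar> \<le> b * card (X \<inter> Z)"
proof -
  have "\<bar>sum f X - sum g X\<bar> \<le> (\<Sum>v\<in>X. \<bar>f v - g v\<bar>)"
    by (metis sum_abs sum_subtractf)
  also have "\<dots> = (\<Sum>v\<in>X \<inter> Z. \<bar>f v - g v\<bar>)"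
    using assms by (intro sum.mono_neutral_right) auto
  also have "\<dots> \<le> (\<Sum>v\<in>X \<inter> Z. b)"
    using assms by (intro sum_mono) auto
  finally show ?thesis by (simp add: mult.commute)
qed

lemma sum_indicat_real: "finite A \<Longrightarrow> (\<Sum>x\<in>A. indicat_real B x) = card (A \<inter> B)"
  by (simp add: indicator_def of_bool_def sum.If_cases Int_def)

text \<open>Applied twice to a set, this contains every start from which a walk can meet the set
  within two steps, provided adjacency is symmetric.\<close>

definition closed_nbhd :: "'a sgraph \<Rightarrow> 'a set \<Rightarrow> 'a set" where
  "closed_nbhd G X = X \<union> (\<Union>x\<in>X. nbrs G x)"

text \<open>Probability that the walk from \<open>v\<close> is in \<open>X\<close> after steps 1 and
  2, summed over the first step \<open>w\<close>; \<open>v\<close> itself may lie outside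
  \<open>X\<close>. Division by zero gives 0 at isolated vertices.\<close>

definition two_step_prob :: "'a sgraph \<Rightarrow> 'a set \<Rightarrow> 'a \<Rightarrow> real" where
  "two_step_prob G X v =
     (\<Sum>w \<in> nbrs G v \<inter> X. card (nbrs G w \<inter> X) / card (nbrs G w)) / card (nbrs G v)"

text \<open>Condition on the start, then on the first step. Nonempty neighbourhoods make each
  \<open>pmf_of_set\<close> a genuine uniform distribution.\<close>

lemma P2_eq:
  assumes "finite (verts G)" and ne: "\<And>v. v \<in> verts G \<Longrightarrow> nbrs G v \<noteq> {}"
    and X: "X \<subseteq> verts G" "X \<noteq> {}"
  shows "P2 G X = (\<Sum>v\<in>X. two_step_prob G X v) / card X"
proof -
  have finX: "finite X" using assms finite_subset by blast
  have finN: "finite (nbrs G v)" for v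
    using assms(1) unfolding nbrs_def by simp
  have sub: "w \<in> verts G" if "w \<in> nbrs G v" for v w
    using that unfolding nbrs_def by simp
  let ?I = "indicator {(v1, v2). v1 \<in> X \<and> v2 \<in> X} :: 'a \<times> 'a \<Rightarrow> real"
  have 1: "measure_pmf.expectation (bind_pmf (pmf_of_set (nbrs G w)) (\<lambda>u. return_pmf (w, u))) ?I
      = indicat_real X w * (card (nbrs G w \<inter> X) / card (nbrs G w))" if "w \<in> verts G" for w
  proof -
    have "measure_pmf.expectation (bind_pmf (pmf_of_set (nbrs G w)) (\<lambda>u. return_pmf (w, u))) ?I
        = (\<Sum>u\<in>nbrs G w. ?I (w, u)) / card (nbrs G w)"
      by (subst pmf_expectation_bind_pmf_of_set)
         (use ne[OF that] finN in \<open>auto simp: divide_inverse sum_distrib_left mult.commute\<close>)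
    also have "(\<Sum>u\<in>nbrs G w. ?I (w, u)) = (\<Sum>u\<in>nbrs G w. indicat_real X w * indicat_real X u)"
      by (intro sum.cong) (auto simp: indicator_def)
    also have "\<dots> = indicat_real X w * card (nbrs G w \<inter> X)"
      using finN by (simp add: sum_distrib_left[symmetric] sum_indicat_real)
    finally show ?thesis by simp
  qed
  have 2: "measure_pmf.expectation (bind_pmf (pmf_of_set (nbrs G v)) (\<lambda>w.
      bind_pmf (pmf_of_set (nbrs G w)) (\<lambda>u. return_pmf (w, u)))) ?I
      = two_step_prob G X v" if "v \<in> verts G" for v
  proof -
    have "measure_pmf.expectation (bind_pmf (pmf_of_set (nbrs G v)) (\<lambda>w.
      bind_pmf (pmf_of_set (nbrs G w)) (\<lambda>u. return_pmf (w, u)))) ?I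
      = (\<Sum>w\<in>nbrs G v. measure_pmf.expectation
           (bind_pmf (pmf_of_set (nbrs G w)) (\<lambda>u. return_pmf (w, u))) ?I /\<^sub>R card (nbrs G v))"
      by (subst pmf_expectation_bind_pmf_of_set)
         (use ne[OF that] finN ne sub in \<open>auto simp: set_pmf_of_set\<close>)
    also have "\<dots> = (\<Sum>w\<in>nbrs G v. (indicat_real X w * (card (nbrs G w \<inter> X) / card (nbrs G w)))
        / card (nbrs G v))"
      using 1 sub by (intro sum.cong) (auto simp: divide_inverse)
    also have "\<dots> = (\<Sum>w\<in>nbrs G v. (indicat_real X w * (card (nbrs G w \<inter> X) / card (nbrs G w))))
        / card (nbrs G v)"
      by (simp add: sum_divide_distrib)
    also have "(\<Sum>w\<in>nbrs G v. (indicat_real X w * (card (nbrs G w \<inter> X) / card (nbrs G w)))) =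
      (\<Sum>w\<in>nbrs G v \<inter> X. card (nbrs G w \<inter> X) / card (nbrs G w))"
      using finN by (intro sum.mono_neutral_cong_right) auto
    finally show ?thesis unfolding two_step_prob_def .
  qed
  have "P2 G X = measure_pmf.expectation (two_step_walk G X) ?I"
    unfolding P2_def by simp
  also have "\<dots> = (\<Sum>v\<in>X. two_step_prob G X v /\<^sub>R card X)"
    unfolding two_step_walk_def
    by (subst pmf_expectation_bind_pmf_of_set)
       (use X finX finN ne sub 2 in \<open>auto simp: set_pmf_of_set subset_eq intro!: sum.cong\<close>)
  finally show ?thesis by (simp add: divide_inverse mult.commute sum_distrib_left)
qed

text \<open>Hence an exceptional start costs at most 1 in a sum compared with values in
  [0, 1].\<close>

lemma two_step_prob_bounds:
  assumes "finite (verts G)"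
  shows "0 \<le> two_step_prob G X v" and "two_step_prob G X v \<le> 1"
proof -
  have finN: "finite (nbrs G v)" for v
    using assms(1) unfolding nbrs_def by simp
  show "0 \<le> two_step_prob G X v"
    unfolding two_step_prob_def by (intro divide_nonneg_nonneg sum_nonneg) auto
  have "(\<Sum>w \<in> nbrs G v \<inter> X. card (nbrs G w \<inter> X) / card (nbrs G w))
      \<le> (\<Sum>w \<in> nbrs G v \<inter> X. 1 :: real)"
    by (intro sum_mono) (auto simp: divide_le_eq_1 intro!: card_mono finN)
  also have "\<dots> \<le> card (nbrs G v)"
    using finN by (simp add: card_mono)
  finally show "two_step_prob G X v \<le> 1"
    unfolding two_step_prob_def by (cases "card (nbrs G v) = 0") (simp_all add: divide_le_eq_1)
qed

text \<open>Double counting of the adjacent pairs between \<open>P\<close> and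
  \<open>Q\<close>.\<close>

lemma sum_card_nbrs_swap:
  assumes "finite (verts G)" and "\<And>u v. adj G u v \<Longrightarrow> adj G v u"
    and "P \<subseteq> verts G" and "Q \<subseteq> verts G"
  shows "(\<Sum>v\<in>P. card (nbrs G v \<inter> Q)) = (\<Sum>v\<in>Q. card (nbrs G v \<inter> P))"
proof -
  have *: "card (nbrs G v \<inter> Y) = (\<Sum>w\<in>Y. if adj G v w then 1 else 0)" if "Y \<subseteq> verts G" for v Y
  proof -
    have "finite Y" using assms(1) that finite_subset by blast
    then have "(\<Sum>w\<in>Y. if adj G v w then 1 else 0) = card {w \<in> Y. adj G v w}"
      by (simp add: sum.If_cases Int_def)
    also have "{w \<in> Y. adj G v w} = nbrs G v \<inter> Y"
      using that unfolding nbrs_def by auto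
    finally show ?thesis by simp
  qed
  have "(\<Sum>v\<in>P. card (nbrs G v \<inter> Q)) = (\<Sum>v\<in>P. \<Sum>w\<in>Q. if adj G v w then 1 else 0)"
    using * assms by simp
  also have "\<dots> = (\<Sum>w\<in>Q. \<Sum>v\<in>P. if adj G v w then 1 else 0)"
    by (rule sum.swap)
  also have "\<dots> = (\<Sum>w\<in>Q. \<Sum>v\<in>P. if adj G w v then 1 else 0)"
    using assms(2) by (intro sum.cong refl if_cong) auto
  finally show ?thesis using * assms by simp
qed

section \<open>Estimates in a finite graph that looks like a cut cover outside a small set\<close>

text \<open>
  \<open>P\<close> and \<open>Q\<close> are the parts of the slab outside and inside \<open>S\<close>, \<open>W\<close> is the rest of the torus, and
  \<open>Z\<close> collects the vertices at which the local structure of the grid may fail.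
\<close>

locale approx_cover =
  fixes G :: "'a sgraph" and d r :: nat and P Q W Z :: "'a set"
  assumes fin: "finite (verts G)"
    and sym: "adj G u v \<Longrightarrow> adj G v u"
    and deg_le: "v \<in> verts G \<Longrightarrow> card (nbrs G v) \<le> d"
    and nbrs_ne: "v \<in> verts G \<Longrightarrow> nbrs G v \<noteq> {}"
    and r_le: "r \<le> d" and d_pos: "0 < d"
    and partition: "verts G = P \<union> Q \<union> W" "P \<inter> Q = {}" "P \<inter> W = {}" "Q \<inter> W = {}"
    and Z_sub: "Z \<subseteq> verts G"
    and deg_eq: "v \<in> verts G - Z \<Longrightarrow> card (nbrs G v) = d"
    and P_nbrs: "v \<in> P - Z \<Longrightarrow> card (nbrs G v \<inter> P) = d - r \<and> card (nbrs G v \<inter> Q) = r"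
    and Q_nbrs: "v \<in> Q - Z \<Longrightarrow> nbrs G v \<subseteq> P"
    and W_nbrs: "v \<in> W - Z \<Longrightarrow> nbrs G v \<subseteq> W"
begin

lemma finite_parts: "finite P" "finite Q" "finite W" "finite Z"
  using fin finite_subset[OF Z_sub] partition(1) by auto

lemma finite_nbrs: "finite (nbrs G v)"
  using fin unfolding nbrs_def by simp

lemma nbrs_sub: "nbrs G v \<subseteq> verts G"
  unfolding nbrs_def by simp

text \<open>Count the adjacent pairs between \<open>P\<close> and \<open>Q\<close> from both sides:
  a regular vertex of \<open>Q\<close> contributes \<open>d\<close>, one of \<open>P\<close>
  contributes \<open>r\<close>, and a vertex of \<open>Z\<close> is off by at most
  \<open>d\<close>.\<close>

lemma edge_count: "\<bar>real d * card Q - real r * card P\<bar> \<le> d * card Z"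
proof -
  have le: "card (nbrs G v \<inter> Y) \<le> d" if "v \<in> verts G" for v Y
    using deg_le[OF that] card_mono[OF finite_nbrs, of "nbrs G v \<inter> Y" v] by auto
  have "\<bar>(\<Sum>v\<in>Q. real (card (nbrs G v \<inter> P))) - (\<Sum>v\<in>Q. real d)\<bar> \<le> real d * real (card (Q \<inter> Z))"
  proof (rule sum_approx)
    fix v assume "v \<in> Q"
    then show "\<bar>real (card (nbrs G v \<inter> P)) - real d\<bar> \<le> d"
      using le[of v P] partition by auto
  next
    fix v assume v: "v \<in> Q - Z"
    then have "nbrs G v \<inter> P = nbrs G v" using Q_nbrs by auto
    then show "real (card (nbrs G v \<inter> P)) = d"
      using deg_eq v partition by auto
  qed (use finite_parts in auto)
  moreover have "\<bar>(\<Sum>v\<in>P. real (card (nbrs G v \<inter> Q))) - (\<Sum>v\<in>P. real r)\<bar> \<le> real d * real (card (P \<inter> Z))"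
  proof (rule sum_approx)
    fix v assume "v \<in> P"
    then show "\<bar>real (card (nbrs G v \<inter> Q)) - real r\<bar> \<le> d"
      using le[of v Q] partition r_le by auto
  qed (use finite_parts P_nbrs in auto)
  moreover have "(\<Sum>v\<in>P. real (card (nbrs G v \<inter> Q))) = (\<Sum>v\<in>Q. real (card (nbrs G v \<inter> P)))"
  proof -
    have "P \<subseteq> verts G" "Q \<subseteq> verts G" using partition(1) by auto
    then show ?thesis
      using sum_card_nbrs_swap[OF fin sym, of P Q] by (simp flip: of_nat_sum)
  qed
  ultimately have "\<bar>real d * card Q - real r * card P\<bar> \<le> real d * card (Q \<inter> Z) + real d * card (P \<inter> Z)"
    by (simp add: mult.commute)
  also have "\<dots> = d * card ((Q \<inter> Z) \<union> (P \<inter> Z))"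
    using finite_parts partition(2) by (subst card_Un_disjoint) (auto simp: algebra_simps)
  also have "\<dots> \<le> d * card Z"
    using finite_parts by (intro of_nat_mono mult_le_mono2 card_mono) auto
  finally show ?thesis by simp
qed

lemma closed_nbhd_sub: "X \<subseteq> verts G \<Longrightarrow> closed_nbhd G X \<subseteq> verts G"
  using nbrs_sub unfolding closed_nbhd_def by auto

lemma card_closed_nbhd_le:
  assumes "X \<subseteq> verts G"
  shows "card (closed_nbhd G X) \<le> (d + 1) * card X"
proof -
  have "finite X" using assms fin finite_subset by blast
  have "card (closed_nbhd G X) \<le> card X + card (\<Union>x\<in>X. nbrs G x)"
    unfolding closed_nbhd_def by (rule card_Un_le)
  also have "card (\<Union>x\<in>X. nbrs G x) \<le> (\<Sum>x\<in>X. card (nbrs G x))"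
    using \<open>finite X\<close> by (rule card_UN_le)
  also have "\<dots> \<le> (\<Sum>x\<in>X. d)"
    using deg_le assms by (intro sum_mono) auto
  finally show ?thesis by (simp add: algebra_simps)
qed

text \<open>Symmetry of adjacency turns "\<open>v\<close> is no neighbour of a point of
  \<open>X\<close>" into "no neighbour of \<open>v\<close> is in \<open>X\<close>".\<close>

lemma not_closed_nbhdD:
  assumes "v \<in> verts G - closed_nbhd G X"
  shows "v \<notin> X" and "w \<in> nbrs G v \<Longrightarrow> w \<notin> X"
  using assms sym unfolding closed_nbhd_def nbrs_def by auto

text \<open>Each of the two steps succeeds with the same conditional probability \<open>c\<close>.
  It is used with \<open>c = \<alpha>\<close> for red starts and \<open>c = 1\<close> for starts in
  \<open>W\<close>.\<close>

lemma two_step_prob_eq: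
  fixes c :: real
  assumes "card (nbrs G v) = d" and "real (card (nbrs G v \<inter> X)) = c * d"
    and "\<And>w. w \<in> nbrs G v \<inter> X \<Longrightarrow> card (nbrs G w) = d \<and> real (card (nbrs G w \<inter> X)) = c * d"
  shows "two_step_prob G X v = c\<^sup>2"
proof -
  have "(\<Sum>w \<in> nbrs G v \<inter> X. card (nbrs G w \<inter> X) / card (nbrs G w)) = (\<Sum>w \<in> nbrs G v \<inter> X. c)"
    using assms(3) d_pos by (intro sum.cong) auto
  then show ?thesis
    using assms d_pos unfolding two_step_prob_def by (simp add: power2_eq_square)
qed

text \<open>\<open>E\<close> is the set recoloured red for exact balance. The denominator of
  \<open>\<delta>\<close> is the size of a colour class; the factor 10 generously covers exceptional
  starts, at most \<open>2 * (d + 1)\<^sup>2 * z\<close>, and an error of \<open>4 * z\<close> in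
  counting the blue part of \<open>W\<close>.\<close>

lemma colouring_estimate:
  assumes "E \<subseteq> verts G - P" and "balanced_colouring G (P \<union> E) (verts G - (P \<union> E))"
    and V_ne: "verts G \<noteq> {}" and E_le: "card E \<le> z" and Z_le: "card Z \<le> z"
  defines "\<alpha> \<equiv> (real d - real r) / real d"
    and "\<delta> \<equiv> 10 * (real d + 1)\<^sup>2 * real z / (real (card (verts G)) / 2)"
  shows "\<bar>P2 G (P \<union> E) - \<alpha>\<^sup>2\<bar> \<le> \<delta>" and "\<bar>P2 G (verts G - (P \<union> E)) - \<alpha>\<bar> \<le> \<delta>"
proof -
  define R where "R = P \<union> E"
  define B where "B = verts G - R"
  define Y where "Y = Z \<union> E"
  define X where "X = closed_nbhd G (closed_nbhd G Y)"
  define h where "h = real (card (verts G)) / 2"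
  have finE: "finite E" using assms(1) fin finite_subset by blast
  have Y_sub: "Y \<subseteq> verts G" using assms(1) Z_sub unfolding Y_def by auto
  have X_sub: "X \<subseteq> verts G" using Y_sub closed_nbhd_sub unfolding X_def by auto
  have finX: "finite X" using X_sub fin finite_subset by blast
  have RV: "R \<subseteq> verts G" using partition assms(1) unfolding R_def by auto
  have finR: "finite R" "finite B" using RV fin finite_subset unfolding B_def by auto
  have cards: "card R = card B" using assms(2) unfolding balanced_colouring_def R_def B_def by auto
  have "card R + card B = card (verts G)"
    unfolding B_def using RV fin card_Diff_subset[of R "verts G"] card_mono[of "verts G" R] finR by simp
  then have hR: "real (card R) = h" and hB: "real (card B) = h"
    unfolding h_def using cards by linarith+
  have h_pos: "h > 0" unfolding h_def using V_ne fin by (simp add: card_gt_0_iff)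
  have ne: "R \<noteq> {}" "B \<noteq> {}" using hR hB h_pos by auto
  have card_Y: "card Y \<le> 2 * z"
    unfolding Y_def using card_Un_le[of Z E] E_le Z_le by linarith
  have "card X \<le> (d + 1) * ((d + 1) * card Y)"
    unfolding X_def using card_closed_nbhd_le closed_nbhd_sub Y_sub
    by (meson le_trans mult_le_mono2)
  also have "\<dots> \<le> (d + 1) * ((d + 1) * (2 * z))"
    using card_Y by (intro mult_le_mono2)
  finally have "real (card X) \<le> real ((d + 1) * ((d + 1) * (2 * z)))"
    by (rule of_nat_mono)
  then have card_X: "real (card X) \<le> 2 * (real d + 1)\<^sup>2 * z"
    by (simp add: power2_eq_square algebra_simps)

  \<comment> \<open>Outside \<open>X\<close> a walk of two steps never meets an exceptional or recoloured vertex.\<close>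
  have near: "v \<in> verts G - Y \<and> (\<forall>w\<in>nbrs G v. w \<in> verts G - Y \<and> (\<forall>u\<in>nbrs G w. u \<notin> Y))"
    if "v \<in> verts G - X" for v
  proof -
    have 1: "v \<in> verts G - closed_nbhd G Y" "\<forall>w\<in>nbrs G v. w \<in> verts G - closed_nbhd G Y"
      using not_closed_nbhdD[of v "closed_nbhd G Y"] that nbrs_sub unfolding X_def by auto
    then show ?thesis using not_closed_nbhdD[of _ Y] by auto
  qed
  have P_loc: "card (nbrs G v) = d \<and> real (card (nbrs G v \<inter> R)) = \<alpha> * d"
    if "v \<in> P" "v \<notin> Y" "\<forall>u\<in>nbrs G v. u \<notin> Y" for v
  proof -
    \<comment> \<open>No neighbour of \<open>v\<close> was recoloured, so its red neighbours are
      those in \<open>P\<close>.\<close>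
    have "nbrs G v \<inter> R = nbrs G v \<inter> P" using that(3) unfolding R_def Y_def by auto
    moreover have "v \<in> P - Z" "v \<in> verts G - Z" using that partition unfolding Y_def by auto
    ultimately show ?thesis using P_nbrs[of v] deg_eq[of v] r_le d_pos
      unfolding \<alpha>_def by (simp add: of_nat_diff)
  qed
  have R_val: "two_step_prob G R v = \<alpha>\<^sup>2" if v: "v \<in> R - X" for v
  proof (rule two_step_prob_eq)
    have n: "v \<in> verts G - Y \<and> (\<forall>w\<in>nbrs G v. w \<in> verts G - Y \<and> (\<forall>u\<in>nbrs G w. u \<notin> Y))"
      using near v RV by blast
    then have "v \<in> P" using v unfolding R_def Y_def by auto
    then show "card (nbrs G v) = d" "real (card (nbrs G v \<inter> R)) = \<alpha> * d"
      using P_loc n by auto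
    fix w assume w: "w \<in> nbrs G v \<inter> R"
    then have "w \<in> P" using n unfolding R_def Y_def by auto
    then show "card (nbrs G w) = d \<and> real (card (nbrs G w \<inter> R)) = \<alpha> * d"
      using P_loc n w by auto
  qed
  \<comment> \<open>Blue starts are all or nothing: from \<open>W\<close> both steps stay in
    \<open>W\<close>, while from \<open>Q\<close> the first step already lands in the red set
    \<open>P\<close>.\<close>
  have B_val: "two_step_prob G B v = indicat_real W v" if v: "v \<in> B - X" for v
  proof -
    have n: "v \<in> verts G - Y \<and> (\<forall>w\<in>nbrs G v. w \<in> verts G - Y \<and> (\<forall>u\<in>nbrs G w. u \<notin> Y))"
      using near v unfolding B_def by blast
    show ?thesis
    proof (cases "v \<in> W")
      case True
      have W_loc: "card (nbrs G v) = d \<and> nbrs G v \<subseteq> W \<and> real (card (nbrs G v \<inter> B)) = 1 * real d"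
        if "v \<in> W" "v \<notin> Y" "\<forall>u\<in>nbrs G v. u \<notin> Y" for v
      proof -
        have "nbrs G v \<subseteq> W" using W_nbrs that unfolding Y_def by auto
        then have "nbrs G v \<inter> B = nbrs G v"
          using that partition unfolding B_def R_def Y_def by auto
        then show ?thesis using deg_eq[of v] partition that \<open>nbrs G v \<subseteq> W\<close> unfolding Y_def by auto
      qed
      have "two_step_prob G B v = 1\<^sup>2"
        using W_loc n True by (intro two_step_prob_eq) blast+
      then show ?thesis using True by simp
    next
      case False
      then have "v \<in> Q" using v partition unfolding B_def R_def by auto
      then have "nbrs G v \<inter> B = {}"
        using Q_nbrs[of v] n unfolding Y_def B_def R_def by auto
      then show ?thesis using False unfolding two_step_prob_def by simp
    qed
  qed
  have "\<bar>(\<Sum>v\<in>R. two_step_prob G R v) - (\<Sum>v\<in>R. \<alpha>\<^sup>2)\<bar> \<le> 1 * real (card (R \<inter> X))"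
  proof (rule sum_approx)
    have "0 \<le> \<alpha>" "\<alpha> \<le> 1" using r_le d_pos unfolding \<alpha>_def by auto
    then have "0 \<le> \<alpha>\<^sup>2" "\<alpha>\<^sup>2 \<le> 1" by (auto simp: power_le_one)
    then show "\<bar>two_step_prob G R v - \<alpha>\<^sup>2\<bar> \<le> 1" for v
      using two_step_prob_bounds[OF fin, of R v] by linarith
  qed (use finR finX R_val in auto)
  also have "1 * real (card (R \<inter> X)) \<le> card X" using finX by (simp add: card_mono)
  finally have R_sum: "\<bar>(\<Sum>v\<in>R. two_step_prob G R v) - \<alpha>\<^sup>2 * h\<bar> \<le> card X"
    using hR by (simp add: mult.commute)
  \<comment> \<open>Both classes have \<open>h\<close> vertices, so dividing by \<open>h\<close>
    turns an error in a sum into an error in \<open>P2\<close>.\<close>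
  have *: "\<bar>s / h - a\<bar> \<le> \<delta>" if "\<bar>s - a * h\<bar> \<le> 10 * (real d + 1)\<^sup>2 * z" for s a
  proof -
    have "\<bar>s / h - a\<bar> = \<bar>s - a * h\<bar> / h"
      using h_pos by (simp add: field_simps flip: abs_div_pos)
    also have "\<dots> \<le> \<delta>"
      unfolding \<delta>_def h_def[symmetric] using that h_pos by (intro divide_right_mono) auto
    finally show ?thesis .
  qed
  have z0: "real z \<le> (real d + 1)\<^sup>2 * z"
    using mult_right_mono[of 1 "(real d + 1)\<^sup>2" "real z"] by (simp add: power2_eq_square algebra_simps)
  have "P2 G R = (\<Sum>v\<in>R. two_step_prob G R v) / h"
    using P2_eq[OF fin nbrs_ne RV ne(1)] hR by simp
  then show "\<bar>P2 G (P \<union> E) - \<alpha>\<^sup>2\<bar> \<le> \<delta>"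
    using *[of _ "\<alpha>\<^sup>2"] R_sum card_X z0 unfolding R_def by simp

  have "\<bar>(\<Sum>v\<in>B. two_step_prob G B v) - (\<Sum>v\<in>B. indicat_real W v)\<bar> \<le> 1 * real (card (B \<inter> X))"
  proof (rule sum_approx)
    show "\<bar>two_step_prob G B v - indicat_real W v\<bar> \<le> 1" for v
      using two_step_prob_bounds[OF fin, of B v] by (auto simp: indicator_def)
  qed (use finR finX B_val in auto)
  also have "1 * real (card (B \<inter> X)) \<le> card X" using finX by (simp add: card_mono)
  also have "(\<Sum>v\<in>B. indicat_real W v) = card (B \<inter> W)"
    using finR by (simp add: sum_indicat_real)
  finally have B_sum: "\<bar>(\<Sum>v\<in>B. two_step_prob G B v) - card (B \<inter> W)\<bar> \<le> card X" .
  \<comment> \<open>The blue sum is now the number of blue vertices in \<open>W\<close>, and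
    recolouring removes at most \<open>card E\<close> of them.\<close>
  have "B \<inter> W = W - E" using partition unfolding B_def R_def by auto
  then have BW: "card (B \<inter> W) \<le> card W" "card W \<le> card (B \<inter> W) + card E"
    using finite_parts finE diff_card_le_card_Diff[of E W] by (auto intro: card_mono)
  have PE: "real (card P) + card E = h"
    using hR assms(1) finite_parts finE unfolding R_def
    by (subst (asm) card_Un_disjoint) auto
  have tot: "real (card P) + card Q + card W = 2 * h"
  proof -
    have "(P \<union> Q) \<inter> W = {}" using partition by blast
    then have "card (verts G) = card P + card Q + card W"
      unfolding partition(1) using finite_parts partition(2) by (simp add: card_Un_disjoint)
    then show ?thesis unfolding h_def by simp
  qed
  \<comment> \<open>By \<open>edge_count\<close>, this is the approximate ratio of
    \<open>card Q\<close> to \<open>card P\<close>.\<close>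
  define \<beta> where "\<beta> = real r / d"
  have \<beta>: "0 \<le> \<beta>" "\<beta> \<le> 1" "\<alpha> = 1 - \<beta>"
    using r_le d_pos unfolding \<beta>_def \<alpha>_def by (auto simp: field_simps)
  have "\<bar>real d * card Q - real r * card P\<bar> = d * \<bar>card Q - \<beta> * card P\<bar>"
  proof -
    have "real d * card Q - real r * card P = d * (card Q - \<beta> * card P)"
      using d_pos unfolding \<beta>_def by (simp add: field_simps)
    then show ?thesis by (simp add: abs_mult)
  qed
  then have Q: "\<bar>card Q - \<beta> * card P\<bar> \<le> card Z"
    using edge_count d_pos by simp
  \<comment> \<open>Eliminate \<open>card W\<close> and \<open>h\<close> by \<open>tot\<close> and
    \<open>PE\<close>. Each of the three terms on the right is at most \<open>z\<close> in absolute
    value; replacing \<open>W\<close> by \<open>B \<inter> W\<close> costs one more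
    \<open>z\<close>.\<close>
  have "card W - \<alpha> * h = card E + \<beta> * card E - (card Q - \<beta> * card P)"
  proof -
    have "\<alpha> * h = h - \<beta> * card P - \<beta> * card E"
      unfolding \<beta>(3) PE[symmetric] by (simp add: algebra_simps)
    then show ?thesis using PE tot by linarith
  qed
  moreover have "0 \<le> \<beta> * card E" "\<beta> * card E \<le> card E"
    using \<beta> by (auto intro: mult_left_le_one_le)
  ultimately have "\<bar>card W - \<alpha> * h\<bar> \<le> 3 * real z"
    using Q E_le Z_le by linarith
  then have "\<bar>(\<Sum>v\<in>B. two_step_prob G B v) - \<alpha> * h\<bar> \<le> card X + 4 * real z"
    using B_sum BW E_le by linarith
  also have "\<dots> \<le> 10 * (real d + 1)\<^sup>2 * z"
    using card_X z0 by simp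
  finally show "\<bar>P2 G (verts G - (P \<union> E)) - \<alpha>\<bar> \<le> \<delta>"
    using *[of _ \<alpha>] P2_eq[OF fin nbrs_ne, of B] ne hB unfolding B_def R_def by simp
qed

end

section \<open>Neighbourhoods and coordinate slices in the grid and the torus\<close>

lemma nbrs_grid_eq:
  assumes "v \<in> verts (grid m)"
  shows "nbrs (grid m) v = (\<lambda>(j, s). v(j := v j + s)) ` ({1..m} \<times> {-1, 1})"
proof (intro set_eqI iffI)
  fix w assume "w \<in> nbrs (grid m) v"
  then obtain j where w: "w \<in> {1..m} \<rightarrow>\<^sub>E UNIV" and j: "j \<in> {1..m}" "\<bar>v j - w j\<bar> = 1"
      "\<forall>i\<in>{1..m}. i \<noteq> j \<longrightarrow> v i = w i"
    unfolding nbrs_def grid_def by auto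
  \<comment> \<open>Both points are extensional, so they also agree outside
    \<open>{1..m}\<close>.\<close>
  have "w = v(j := v j + (w j - v j))"
    using w j assms unfolding grid_def by (auto simp: fun_eq_iff PiE_iff extensional_def)
  moreover have "w j - v j \<in> {-1, 1}" using j(2) by auto
  ultimately show "w \<in> (\<lambda>(j, s). v(j := v j + s)) ` ({1..m} \<times> {-1, 1})"
    using j(1) by (intro image_eqI[of _ _ "(j, w j - v j)"]) auto
next
  fix w assume "w \<in> (\<lambda>(j, s). v(j := v j + s)) ` ({1..m} \<times> {-1, 1})"
  then obtain j s where j: "j \<in> {1..m}" and s: "s \<in> {-1, 1}" and w: "w = v(j := v j + s)"
    by fast
  show "w \<in> nbrs (grid m) v"
    using assms j s unfolding w nbrs_def grid_def
    by (auto simp: PiE_iff extensional_def intro!: bexI[of _ j])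
qed

text \<open>The parametrisation by coordinate and sign is injective: the shift is nonzero, so
  evaluating at \<open>j\<close> recovers both.\<close>

lemma card_nbrs_grid:
  assumes "v \<in> verts (grid m)"
  shows "card (nbrs (grid m) v) = 2 * m"
proof -
  have "inj_on (\<lambda>(j, s). v(j := v j + s)) ({1..m} \<times> {-1, 1 :: int})"
  proof (rule inj_onI, clarify)
    fix j s j' s' assume *: "s \<in> {-1, 1}" "s' \<in> {-1, 1}" "v(j := v j + s) = v(j' := v j' + s')"
    then show "j = j' \<and> s = s'"
      by (auto dest!: fun_cong[of _ _ j] split: if_splits)
  qed
  then show ?thesis
    unfolding nbrs_grid_eq[OF assms] by (subst card_image) (auto simp: card_cartesian_product)
qed

lemma verts_torus: "verts (torus m k) = {1..m} \<rightarrow>\<^sub>E {1..int k}"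
  unfolding torus_def by simp

lemma finite_verts_torus: "finite (verts (torus m k))"
  unfolding verts_torus by (intro finite_PiE) auto

lemma card_verts_torus: "card (verts (torus m k)) = k ^ m"
  unfolding verts_torus by (subst card_PiE) auto

lemma verts_torus_sub_grid: "verts (torus m k) \<subseteq> verts (grid m)"
  unfolding torus_def grid_def by (auto simp: PiE_iff)

lemma adj_torus_sym: "adj (torus m k) x y \<Longrightarrow> adj (torus m k) y x"
proof -
  have "[b = a - 1] (mod c)" if "[a = b + 1] (mod c)" for a b c :: int
    using that by (metis add_diff_cancel_right' cong_diff cong_refl cong_sym)
  moreover have "[b = a + 1] (mod c)" if "[a = b - 1] (mod c)" for a b c :: int
    using that by (metis add.commute cong_add cong_refl cong_sym diff_add_cancel)
  ultimately show "adj (torus m k) x y \<Longrightarrow> adj (torus m k) y x"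
    unfolding torus_def by simp metis
qed

text \<open>One fixed coordinate leaves \<open>m - 1\<close> free ones. Since \<open>c\<close> is
  arbitrary, the slice may be empty.\<close>

lemma card_slice_le:
  assumes "j \<in> {1..m}"
  shows "card {x \<in> verts (torus m k). x j = c} \<le> k ^ (m - 1)"
proof -
  let ?F = "\<lambda>i. if i = j then {c} else {1..int k}"
  have "card {x \<in> verts (torus m k). x j = c} \<le> card (PiE {1..m} ?F)"
    unfolding verts_torus by (intro card_mono finite_PiE) (auto simp: PiE_iff extensional_def)
  also have "\<dots> = (\<Prod>i\<in>{1..m}. card (?F i))" by (simp add: card_PiE)
  also have "\<dots> = card (?F j) * (\<Prod>i\<in>{1..m} - {j}. card (?F i))"
    using assms by (intro prod.remove) auto
  also have "(\<Prod>i\<in>{1..m} - {j}. card (?F i)) = (\<Prod>i\<in>{1..m} - {j}. k)"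
    by (intro prod.cong) auto
  finally show ?thesis using assms by simp
qed

text \<open>Coordinates run from 1 to \<open>k\<close>, so residues are taken after subtracting 1,
  which is then added back. The two signs may give the same neighbour, as for \<open>k = 2\<close>,
  so only an upper bound holds.\<close>

lemma card_nbrs_torus_le:
  assumes "v \<in> verts (torus m k)"
  shows "card (nbrs (torus m k) v) \<le> 2 * m"
proof -
  let ?f = "\<lambda>(j, s). v(j := (v j + s - 1) mod int k + 1)"
  have "nbrs (torus m k) v \<subseteq> ?f ` ({1..m} \<times> {-1, 1})"
  proof
    fix w assume "w \<in> nbrs (torus m k) v"
    then obtain j where w: "w \<in> {1..m} \<rightarrow>\<^sub>E {1..int k}" and j: "j \<in> {1..m}"
        "[v j = w j + 1] (mod int k) \<or> [v j = w j - 1] (mod int k)"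
        "\<forall>i\<in>{1..m}. i \<noteq> j \<longrightarrow> v i = w i"
      unfolding nbrs_def torus_def by auto
    have wj: "(w j - 1) mod int k = w j - 1"
      using PiE_mem[OF w j(1)] by (intro mod_pos_pos_trivial) auto
    obtain s where s: "s \<in> {-1, 1}" "[w j - 1 = v j + s - 1] (mod int k)"
    proof (cases "[v j = w j + 1] (mod int k)")
      case True
      then have "[v j - 2 = w j + 1 - 2] (mod int k)" by (intro cong_diff) auto
      then show ?thesis using that[of "-1"] by (simp add: cong_sym_eq)
    next
      case False
      then have "[v j = w j - 1] (mod int k)" using j by auto
      then show ?thesis using that[of 1] by (simp add: cong_sym_eq)
    qed
    then have "w j = (v j + s - 1) mod int k + 1" using wj unfolding cong_def by simp
    then have "w = ?f (j, s)"
      using w j assms unfolding verts_torus by (auto simp: fun_eq_iff PiE_iff extensional_def)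
    then show "w \<in> ?f ` ({1..m} \<times> {-1, 1})" using s j by blast
  qed
  then have "card (nbrs (torus m k) v) \<le> card (?f ` ({1..m} \<times> {-1, 1 :: int}))"
    by (intro card_mono) auto
  also have "\<dots> \<le> card ({1..m} \<times> {-1, 1 :: int})" by (intro card_image_le) auto
  finally show ?thesis by (simp add: card_cartesian_product)
qed

lemma nbrs_torus_ne:
  assumes "v \<in> verts (torus m k)" and "m \<ge> 1" and "k \<ge> 2"
  shows "nbrs (torus m k) v \<noteq> {}"
proof -
  \<comment> \<open>Step down in the first coordinate, or from 1 up to 2; neither wraps around, and
    2 is allowed because \<open>k \<ge> 2\<close>.\<close>
  define a where "a = (if v 1 = 1 then 2 else v 1 - 1)"
  have v1: "v 1 \<in> {1..int k}" using assms unfolding verts_torus by (auto simp: PiE_iff)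
  have a: "a \<in> {1..int k}" "v 1 \<noteq> a" "v 1 = a + 1 \<or> v 1 = a - 1"
    using v1 assms(3) unfolding a_def by auto
  have "v(1 := a) \<in> nbrs (torus m k) v"
    using assms a unfolding nbrs_def torus_def
    by (auto simp: PiE_iff extensional_def intro!: bexI[of _ 1])
  then show ?thesis by auto
qed

text \<open>With all coordinates between 2 and \<open>k - 1\<close>, no step can wrap
  around.\<close>

lemma nbrs_torus_interior:
  assumes v: "v \<in> verts (torus m k)" and int: "\<And>j. j \<in> {1..m} \<Longrightarrow> v j \<notin> {1, int k}"
  shows "nbrs (torus m k) v = nbrs (grid m) v"
proof (intro set_eqI iffI)
  have rng: "2 \<le> v j" "v j \<le> int k - 1" if "j \<in> {1..m}" for j
  proof -
    have "v j \<in> {1..int k}" using v that unfolding verts_torus by (auto simp: PiE_iff)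
    then show "2 \<le> v j" "v j \<le> int k - 1" using int[OF that] by auto
  qed
  fix w
  {
    assume "w \<in> nbrs (torus m k) v"
    then obtain j where w: "w \<in> {1..m} \<rightarrow>\<^sub>E {1..int k}" and j: "j \<in> {1..m}"
        "[v j = w j + 1] (mod int k) \<or> [v j = w j - 1] (mod int k)"
        "\<forall>i\<in>{1..m}. i \<noteq> j \<longrightarrow> v i = w i"
      unfolding nbrs_def torus_def by auto
    have wj: "1 \<le> w j" "w j \<le> int k" using w j by (auto simp: PiE_iff)
    have "int k dvd (v j - w j - 1) \<or> int k dvd (v j - w j + 1)"
      using j(2) by (auto simp: cong_iff_dvd_diff algebra_simps)
    \<comment> \<open>A multiple of \<open>k\<close> smaller than \<open>k\<close> in absolute value
      is 0, so the congruence becomes an equation.\<close>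
    moreover have "\<bar>v j - w j - 1\<bar> < int k" "\<bar>v j - w j + 1\<bar> < int k"
      using rng[OF j(1)] wj by auto
    ultimately have "v j - w j - 1 = 0 \<or> v j - w j + 1 = 0"
      by (metis abs_ge_zero abs_of_nat dvd_imp_le_int not_less)
    then have "\<bar>v j - w j\<bar> = 1" by auto
    then show "w \<in> nbrs (grid m) v"
      using w j unfolding nbrs_def grid_def by (auto simp: PiE_iff)
  }
  {
    assume "w \<in> nbrs (grid m) v"
    then obtain j where w: "w \<in> {1..m} \<rightarrow>\<^sub>E UNIV" and j: "j \<in> {1..m}" "\<bar>v j - w j\<bar> = 1"
        "\<forall>i\<in>{1..m}. i \<noteq> j \<longrightarrow> v i = w i"
      unfolding nbrs_def grid_def by auto
    have "w i \<in> {1..int k}" if "i \<in> {1..m}" for i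
      using rng[OF that] j that by (cases "i = j") auto
    then have "w \<in> verts (torus m k)" using w unfolding verts_torus by (auto simp: PiE_iff)
    moreover have "v j = w j + 1 \<or> v j = w j - 1" using j(2) by auto
    then have "adj (torus m k) v w"
      unfolding torus_def using j by (auto intro!: bexI[of _ j])
    ultimately show "w \<in> nbrs (torus m k) v" unfolding nbrs_def by simp
  }
qed

section \<open>The torus cut by a slab\<close>

text \<open>The exceptional set consists of the faces, where the torus wraps around, and the layers
  \<open>t\<close> and \<open>t + 1\<close> on either side of the cut. Elsewhere neighbourhoods are
  those of the grid and no step crosses the cut.\<close>

lemma approx_cover_torus:
  fixes t :: int
  assumes cover: "independent_exact_cover (grid m) r S"
    and "m \<ge> 1" and "r \<le> 2 * m" and "k \<ge> 2"
  defines "V \<equiv> verts (torus m k)"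
  shows "approx_cover (torus m k) (2 * m) r {x \<in> V. x \<notin> S \<and> x 1 \<le> t} {x \<in> V. x \<in> S \<and> x 1 \<le> t}
    {x \<in> V. x 1 > t} ({x \<in> V. \<exists>j\<in>{1..m}. x j \<in> {1, int k}} \<union> {x \<in> V. x 1 \<in> {t, t + 1}})"
    (is "approx_cover _ _ _ ?P ?Q ?W ?Z")
proof -
  have S_indep: "\<not> adj (grid m) v w" if "v \<in> S" "w \<in> S" for v w
    using cover that unfolding independent_exact_cover_def independent_set_def by auto
  have S_card: "card (nbrs (grid m) v \<inter> S) = r" if "v \<in> V - S" for v
    using cover that verts_torus_sub_grid unfolding independent_exact_cover_def V_def by auto
  have eq: "nbrs (torus m k) v = nbrs (grid m) v" if "v \<in> V - ?Z" for v
    using that by (intro nbrs_torus_interior) (auto simp: V_def)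
  have sub: "w \<in> V" if "w \<in> nbrs (torus m k) v" for v w
    using that unfolding nbrs_def V_def by simp
  have step: "w 1 \<le> t \<longleftrightarrow> v 1 \<le> t" if "v \<in> V - ?Z" "w \<in> nbrs (torus m k) v" for v w
  proof -
    have "adj (grid m) v w" using that(2) unfolding eq[OF that(1)] by (simp add: nbrs_def)
    then obtain j where "\<bar>v j - w j\<bar> = 1" "\<forall>i\<in>{1..m}. i \<noteq> j \<longrightarrow> v i = w i"
      unfolding grid_def by auto
    then have "\<bar>v 1 - w 1\<bar> \<le> 1" using \<open>m \<ge> 1\<close> by (cases "j = 1") auto
    moreover have "v 1 \<noteq> t" "v 1 \<noteq> t + 1" using that(1) by auto
    ultimately show ?thesis by linarith
  qed
  have card_eq: "card (nbrs (torus m k) v) = 2 * m" if "v \<in> V - ?Z" for v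
  proof -
    have "v \<in> verts (grid m)" using that verts_torus_sub_grid[of m k] unfolding V_def by blast
    then show ?thesis unfolding eq[OF that] by (rule card_nbrs_grid)
  qed
  show ?thesis
  proof
    fix v assume v: "v \<in> ?P - ?Z"
    then have v': "v \<in> V - ?Z" by auto
    have fin: "finite (nbrs (torus m k) v)"
      using finite_verts_torus unfolding nbrs_def by simp
    \<comment> \<open>Neighbours stay in the slab, so \<open>S\<close> alone decides between the two
      parts.\<close>
    have PQ: "nbrs (torus m k) v \<inter> ?P = nbrs (torus m k) v - S"
        "nbrs (torus m k) v \<inter> ?Q = nbrs (torus m k) v \<inter> S"
      using step[OF v'] sub v by auto
    have "card (nbrs (torus m k) v \<inter> S) = r"
      using S_card[of v] eq[OF v'] v by auto
    then show "card (nbrs (torus m k) v \<inter> ?P) = 2 * m - r \<and> card (nbrs (torus m k) v \<inter> ?Q) = r"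
      unfolding PQ using card_eq[OF v'] fin by (simp add: card_Diff_subset_Int)
  next
    fix v assume v: "v \<in> ?Q - ?Z"
    then have v': "v \<in> V - ?Z" by auto
    have "w \<notin> S" if "w \<in> nbrs (torus m k) v" for w
      using that S_indep[of v w] v unfolding eq[OF v'] by (auto simp: nbrs_def)
    then show "nbrs (torus m k) v \<subseteq> ?P" using step[OF v'] sub v by auto
  next
    fix v assume v: "v \<in> ?W - ?Z"
    then have v': "v \<in> V - ?Z" by auto
    show "nbrs (torus m k) v \<subseteq> ?W" using step[OF v'] sub v by force
  next
    fix u v assume "adj (torus m k) u v"
    then show "adj (torus m k) v u" by (rule adj_torus_sym)
  next
    fix v assume v: "v \<in> verts (torus m k)"
    show "card (nbrs (torus m k) v) \<le> 2 * m" using v by (rule card_nbrs_torus_le)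
    show "nbrs (torus m k) v \<noteq> {}" using v assms by (intro nbrs_torus_ne) auto
  next
    show "card (nbrs (torus m k) v) = 2 * m" if "v \<in> verts (torus m k) - ?Z" for v
      using card_eq that unfolding V_def by blast
  qed (use assms finite_verts_torus in \<open>auto simp: V_def\<close>)
qed

text \<open>There are \<open>2 * m\<close> faces and two layers at the cut, each a coordinate
  slice.\<close>

lemma card_boundary_le:
  fixes t :: int and k :: nat
  assumes "m \<ge> 1"
  defines "V \<equiv> verts (torus m k)"
  shows "card ({x \<in> V. \<exists>j\<in>{1..m}. x j \<in> {1, int k}} \<union> {x \<in> V. x 1 \<in> {t, t + 1}})
    \<le> (2 * m + 2) * k ^ (m - 1)" (is "card (?F \<union> ?T) \<le> _")
proof -
  let ?s = "\<lambda>j c. {x \<in> V. x j = c}"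
  have s: "card (?s j c) \<le> k ^ (m - 1)" if "j \<in> {1..m}" for j c
    using card_slice_le[OF that] unfolding V_def .
  have two: "card (?s j c \<union> ?s j c') \<le> 2 * k ^ (m - 1)" if "j \<in> {1..m}" for j c c'
    using s[OF that, of c] s[OF that, of c'] card_Un_le[of "?s j c" "?s j c'"] by linarith
  have F: "?F = (\<Union>j\<in>{1..m}. ?s j 1 \<union> ?s j (int k))" by auto
  have "card ?F \<le> (\<Sum>j\<in>{1..m}. card (?s j 1 \<union> ?s j (int k)))"
    unfolding F by (intro card_UN_le) simp
  also have "\<dots> \<le> (\<Sum>j\<in>{1..m}. 2 * k ^ (m - 1))" using two by (intro sum_mono) auto
  finally have "card ?F \<le> 2 * m * k ^ (m - 1)" by simp
  moreover have "?T = ?s 1 t \<union> ?s 1 (t + 1)" by auto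
  then have "card ?T \<le> 2 * k ^ (m - 1)" using two[of 1 t "t + 1"] assms by simp
  ultimately show ?thesis using card_Un_le[of ?F ?T] by (simp add: algebra_simps)
qed

section \<open>Balanced colourings of even tori and the limit\<close>

text \<open>Stop the slab when \<open>P t\<close> is at most \<open>z\<close> short of half the
  torus, then fill up with \<open>E\<close>. Even \<open>k\<close> makes the number of vertices
  even.\<close>

lemma ex_colouring_torus:
  assumes cover: "independent_exact_cover (grid m) r S"
    and m: "m \<ge> 1" and r: "r \<le> 2 * m" and k: "k \<ge> 2" "even k"
  defines "\<alpha> \<equiv> (2 * real m - real r) / (2 * real m)"
    and "\<delta> \<equiv> 20 * (2 * real m + 1)\<^sup>2 * (2 * real m + 2) / real k"
  shows "\<exists>R B. balanced_colouring (torus m k) R B \<and>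
    \<bar>P2 (torus m k) R - \<alpha>\<^sup>2\<bar> \<le> \<delta> \<and> \<bar>P2 (torus m k) B - \<alpha>\<bar> \<le> \<delta>"
proof -
  define V where "V = verts (torus m k)"
  define P where "P t = {x \<in> V. x \<notin> S \<and> x 1 \<le> t}" for t
  define Q where "Q t = {x \<in> V. x \<in> S \<and> x 1 \<le> t}" for t
  define W where "W t = {x \<in> V. x 1 > t}" for t
  define Z where "Z t = {x \<in> V. \<exists>j\<in>{1..m}. x j \<in> {1, int k}} \<union> {x \<in> V. x 1 \<in> {t, t + 1}}" for t
  define z where "z = (2 * m + 2) * k ^ (m - 1)"
  define h where "h = k ^ m div 2"
  have ac: "approx_cover (torus m k) (2 * m) r (P t) (Q t) (W t) (Z t)" for t
    using approx_cover_torus[OF cover m r k(1)] unfolding P_def Q_def W_def Z_def V_def .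
  have Z_le: "card (Z t) \<le> z" for t
    using card_boundary_le[OF m] unfolding Z_def V_def z_def .
  have finV: "finite V" unfolding V_def by (rule finite_verts_torus)
  have finP: "finite (P t)" "P t \<subseteq> V" for t using finV unfolding P_def by auto
  have "even (k ^ m)" using k m by simp
  then have V_card: "card V = 2 * h" unfolding V_def h_def card_verts_torus by simp
  have V_rng: "1 \<le> x 1 \<and> x 1 \<le> int k" if "x \<in> V" for x
    using that m unfolding V_def verts_torus by (auto simp: PiE_iff)
  obtain t where t: "card (P t) \<le> h" "h \<le> card (P t) + z"
  \<comment> \<open>Even the full torus may have at most half its vertices outside \<open>S\<close>,
    as for \<open>r = 2 * m\<close>. Then \<open>edge_count\<close> and \<open>r \<le> 2 * m\<close>
    give \<open>card Q \<le> card P + card Z\<close>, so \<open>P\<close> is still nearly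
    half.\<close>
  proof (cases "card (P (int k)) \<le> h")
    case True
    interpret approx_cover "torus m k" "2 * m" r "P (int k)" "Q (int k)" "W (int k)" "Z (int k)"
      by (rule ac)
    have "W (int k) = {}" using V_rng unfolding W_def by force
    then have "card (P (int k)) + card (Q (int k)) = 2 * h"
      using partition finite_parts V_card unfolding V_def by (simp add: card_Un_disjoint)
    moreover have "real (2 * m) * card (Q (int k)) \<le> real (2 * m) * (card (P (int k)) + card (Z (int k)))"
    proof -
      have "real r * card (P (int k)) \<le> real (2 * m) * card (P (int k))"
        using r by (intro mult_right_mono) auto
      then show ?thesis using edge_count by (simp add: algebra_simps)
    qed
    then have "card (Q (int k)) \<le> card (P (int k)) + card (Z (int k))"
      using m by (simp del: of_nat_add add: of_nat_add[symmetric])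
    ultimately have "h \<le> card (P (int k)) + z" using Z_le[of "int k"] by linarith
    then show ?thesis using that True by blast
  next
    case False
    have "P 0 = {}" using V_rng unfolding P_def by force
    \<comment> \<open>Discrete continuity: take the last layer before the count first exceeds
      \<open>h\<close>; one more layer adds at most \<open>k ^ (m - 1)\<close> vertices.\<close>
    then obtain n where n: "card (P (int n)) \<le> h" "\<not> card (P (int (Suc n))) \<le> h"
      using ex_least_nat_less[of "\<lambda>n. h < card (P (int n))" k] False by (auto simp: not_less)
    have "P (int (Suc n)) \<subseteq> P (int n) \<union> {x \<in> V. x 1 = int n + 1}"
      unfolding P_def by auto
    then have "card (P (int (Suc n))) \<le> card (P (int n) \<union> {x \<in> V. x 1 = int n + 1})"
      using finP finV by (intro card_mono) auto
    also have "\<dots> \<le> card (P (int n)) + card {x \<in> V. x 1 = int n + 1}" by (rule card_Un_le)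
    also have "card {x \<in> V. x 1 = int n + 1} \<le> k ^ (m - 1)"
      unfolding V_def using m by (intro card_slice_le) auto
    also have "\<dots> \<le> z" unfolding z_def by simp
    finally show ?thesis using that n by auto
  qed
  interpret approx_cover "torus m k" "2 * m" r "P t" "Q t" "W t" "Z t" by (rule ac)
  have "h - card (P t) \<le> card (V - P t)"
    using V_card finP by (simp add: card_Diff_subset)
  then obtain E where E: "E \<subseteq> V - P t" "card E = h - card (P t)" "finite E"
    by (rule obtain_subset_with_card_n)
  have "card (P t \<union> E) = h" using E finP t by (subst card_Un_disjoint) auto
  moreover from this have "card (V - (P t \<union> E)) = h"
    using E finP V_card by (subst card_Diff_subset) auto
  ultimately have bal: "balanced_colouring (torus m k) (P t \<union> E) (verts (torus m k) - (P t \<union> E))"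
    using E finP[of t] finV unfolding balanced_colouring_def V_def by auto
  have V_ne: "verts (torus m k) \<noteq> {}"
    using V_card card_verts_torus[of m k] k by (metis card.empty power_not_zero not_numeral_le_zero)
  have "real k ^ m = real k * real k ^ (m - 1)" using m by (cases m) auto
  \<comment> \<open>A factor \<open>k ^ (m - 1)\<close> cancels, leaving \<open>1 / k\<close>;
    halving the denominator turns 10 into 20.\<close>
  then have \<delta>: "10 * (real (2 * m) + 1)\<^sup>2 * real z / (real (card (verts (torus m k))) / 2) = \<delta>"
    unfolding \<delta>_def z_def card_verts_torus using k by (simp add: field_simps)
  have \<alpha>: "(real (2 * m) - real r) / real (2 * m) = \<alpha>" unfolding \<alpha>_def by simp
  show ?thesis
    using colouring_estimate[OF _ bal V_ne _ Z_le] E t bal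
    unfolding \<delta> \<alpha> V_def by fastforce
qed

theorem theorem3:
  fixes m r :: nat
  assumes "m \<ge> 2" and "r \<le> 2 * m"
    and "\<exists>S. independent_exact_cover (grid m) r S"
  shows "(((2 * real m - real r) / (2 * real m))\<^sup>2, (2 * real m - real r) / (2 * real m))
           \<in> achievable_pairs (torus m)"
proof -
  define \<alpha> where "\<alpha> = (2 * real m - real r) / (2 * real m)"
  define C where "C = 20 * (2 * real m + 1)\<^sup>2 * (2 * real m + 2)"
  obtain S where S: "independent_exact_cover (grid m) r S" using assms(3) by auto
  have "\<exists>k\<ge>1. \<exists>R B. balanced_colouring (torus m k) R B \<and>
     \<bar>P2 (torus m k) R - \<alpha>\<^sup>2\<bar> < \<epsilon> \<and> \<bar>P2 (torus m k) B - \<alpha>\<bar> < \<epsilon>" if "\<epsilon> > 0" for \<epsilon>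
  proof -
    obtain n :: nat where n: "C / \<epsilon> < n" using reals_Archimedean2 by blast
    \<comment> \<open>Even, at least 2, and larger than \<open>C / \<epsilon>\<close>.\<close>
    define k where "k = 2 * (n + 1)"
    have k: "k \<ge> 2" "even k" "real k > n" unfolding k_def by auto
    have "C < \<epsilon> * n" using n that by (simp add: field_simps)
    also have "\<dots> \<le> \<epsilon> * k" using k(3) that by (intro mult_left_mono) auto
    finally have "C / k < \<epsilon>" using k by (simp add: field_simps)
    moreover obtain R B where "balanced_colouring (torus m k) R B"
        "\<bar>P2 (torus m k) R - \<alpha>\<^sup>2\<bar> \<le> C / k" "\<bar>P2 (torus m k) B - \<alpha>\<bar> \<le> C / k"
      using ex_colouring_torus[OF S _ assms(2) k(1,2)] assms(1) unfolding \<alpha>_def C_def by auto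
    ultimately show ?thesis using k(1)
      by (intro exI[of _ k] conjI exI[of _ R] exI[of _ B]) linarith+
  qed
  then show ?thesis unfolding achievable_pairs_def \<alpha>_def by simp
qed

end
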